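(* The finite Markov chains with state space $\{0,\dots,N\}$ and transition matrices $\tilde P^{[N]}_{II}$ and $\tilde P^{[N]}_{I}$ are recurrent.
   Context: Fix an integer $p\ge 1$; $\mathbb N_0=\{0,1,2,\dots\}$. $T=(T_{i,j})_{i,j\ge 0}$ is a real semi-infinite monic banded lower Hessenberg matrix: $T_{n,n+1}=1$, $T_{i,j}=0$ if $j>i+1$ or $j<i-p$, and $T_{n,n-p}\neq0$ for $n\ge p$. $T^{[N]}=(T_{i,j})_{0\le i,j\le N}$. $T$ admits a positive bidiagonal factorization: $T=L_1\cdots L_pU$, where $L_k$ is lower bidiagonal with unit diagonal and $(L_k)_{j+1,j}=\alpha_{k+1+j(p+1)}$, $U$ is upper bidiagonal with unit superdiagonal and $U_{j,j}=\alpha_{1+j(p+1)}$ ($j\in\mathbb N_0$), and all $\alpha_i>0$. Moreover $T$ is associated with a semi-infinite stochastic matrix: there is a diagonal matrix $\pi$ with positive diagonal entries such that $\pi T\pi^{-1}$ or $\pi^{-1}T^\top\pi$ is stochastic. Type II polynomials: $B_0=1$, $B_{n+1}=(x-T_{n,n})B_n-T_{n,n-1}B_{n-1}-\cdots-T_{n,n-p}B_{n-p}$ (terms with negative index are $0$). The eigenvalues of $T^{[N]}$ are simple and positive; $\lambda_1^{[N]}$ is the largest one. Truncated polynomials: $B^{[k]}_{N+1}(x)=\det(xI_{N+1-k}-T^{[N,k]})$ with $T^{[N,k]}=(T_{i,j})_{k\le i,j\le N}$, and $B^{[N+1]}_{N+1}=1$. The finite stochastic matrices are $\tilde P^{[N]}_{II}=\tilde\pi_{II}\,\frac{T^{[N]}}{\lambda_1^{[N]}}\,\tilde\pi_{II}^{-1}$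 and $\tilde P^{[N]}_{I}=\tilde\pi_{I}^{-1}\,\frac{(T^{[N]})^\top}{\lambda_1^{[N]}}\,\tilde\pi_{I}$, where $\tilde\pi_{II}=\mathrm{diag}(\tilde\pi_{II,0},\dots,\tilde\pi_{II,N})$, $\tilde\pi_{II,n}=1/B_n(\lambda_1^{[N]})$, and $\tilde\pi_{I}=\mathrm{diag}(\tilde\pi_{I,0},\dots,\tilde\pi_{I,N})$, $\tilde\pi_{I,n}=B^{[n+1]}_{N+1}(\lambda_1^{[N]})/B^{[1]}_{N+1}(\lambda_1^{[N]})$ (all these numbers are positive). A Markov chain is recurrent if each of its states is recurrent, i.e. started at a state it returns to it with probability one. *)

theory Defs
  imports
    "HOL-Probability.Probability"
    "Jordan_Normal_Form.Char_Poly"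
begin

section \<open>Semi-infinite matrices\<close>

text \<open>A semi-infinite real matrix is a function \<^typ>\<open>nat \<Rightarrow> nat \<Rightarrow> real\<close>, with both indices starting
  at 0.\<close>

definition banded_hessenberg :: "nat \<Rightarrow> (nat \<Rightarrow> nat \<Rightarrow> real) \<Rightarrow> bool" where
  "banded_hessenberg p T \<longleftrightarrow>
     (\<forall>n. T n (n + 1) = 1) \<and>
     (\<forall>i j. j > i + 1 \<or> j + p < i \<longrightarrow> T i j = 0) \<and>
     (\<forall>n\<ge>p. T n (n - p) \<noteq> 0)"

text \<open>The products below only involve left factors with finitely many nonzero entries in each row, so
  the series is a finite sum.\<close>

definition smat_mult :: "(nat \<Rightarrow> nat \<Rightarrow> real) \<Rightarrow> (nat \<Rightarrow> nat \<Rightarrow> real) \<Rightarrow> nat \<Rightarrow> nat \<Rightarrow> real" where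
  "smat_mult A B = (\<lambda>i j. \<Sum>k. A i k * B k j)"

definition lower_bidiagonal :: "nat \<Rightarrow> (nat \<Rightarrow> real) \<Rightarrow> nat \<Rightarrow> nat \<Rightarrow> nat \<Rightarrow> real" where
  "lower_bidiagonal p \<alpha> k = (\<lambda>i j.
     if i = j then 1 else if i = j + 1 then \<alpha> (k + 1 + j * (p + 1)) else 0)"

definition upper_bidiagonal :: "nat \<Rightarrow> (nat \<Rightarrow> real) \<Rightarrow> nat \<Rightarrow> nat \<Rightarrow> real" where
  "upper_bidiagonal p \<alpha> = (\<lambda>i j.
     if i = j then \<alpha> (1 + j * (p + 1)) else if j = i + 1 then 1 else 0)"

text \<open>The \<open>\<alpha>\<close>-sequence is indexed from 1; \<open>\<alpha> 0\<close> is never used. The \<^const>\<open>foldr\<close> is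
  \<open>L\<^sub>1 (L\<^sub>2 (\<dots> (L\<^sub>p U)))\<close>.\<close>

definition positive_bidiagonal_factorization :: "nat \<Rightarrow> (nat \<Rightarrow> nat \<Rightarrow> real) \<Rightarrow> bool" where
  "positive_bidiagonal_factorization p T \<longleftrightarrow>
     (\<exists>\<alpha>. (\<forall>i\<ge>1. \<alpha> i > 0) \<and>
        T = foldr smat_mult (map (lower_bidiagonal p \<alpha>) [1..<p + 1]) (upper_bidiagonal p \<alpha>))"

definition stochastic_on :: "'s set \<Rightarrow> ('s \<Rightarrow> 's \<Rightarrow> real) \<Rightarrow> bool" where
  "stochastic_on S P \<longleftrightarrow> (\<forall>i\<in>S. (\<forall>j\<in>S. P i j \<ge> 0) \<and> ((\<lambda>j. P i j) has_sum 1) S)"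

definition associated_stochastic :: "(nat \<Rightarrow> nat \<Rightarrow> real) \<Rightarrow> bool" where
  "associated_stochastic T \<longleftrightarrow>
     (\<exists>\<pi>::nat \<Rightarrow> real. (\<forall>n. \<pi> n > 0) \<and>
        (stochastic_on UNIV (\<lambda>i j. \<pi> i * T i j * inverse (\<pi> j)) \<or>
         stochastic_on UNIV (\<lambda>i j. inverse (\<pi> i) * T j i * \<pi> j)))"


section \<open>Truncations and polynomials\<close>

text \<open>\<open>trunc_mat T N k\<close> is the block of \<open>T\<close> with row and column indices \<open>k, \<dots>, N\<close>; it is
  the \<open>0 \<times> 0\<close> matrix for \<open>k = N + 1\<close>.\<close>

definition trunc_mat :: "(nat \<Rightarrow> nat \<Rightarrow> real) \<Rightarrow> nat \<Rightarrow> nat \<Rightarrow> real mat" where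
  "trunc_mat T N k = mat (N + 1 - k) (N + 1 - k) (\<lambda>(i, j). T (i + k) (j + k))"

definition largest_eigenvalue :: "(nat \<Rightarrow> nat \<Rightarrow> real) \<Rightarrow> nat \<Rightarrow> real" where
  "largest_eigenvalue T N = Max {x. eigenvalue (trunc_mat T N 0) x}"

fun type_II_poly :: "nat \<Rightarrow> (nat \<Rightarrow> nat \<Rightarrow> real) \<Rightarrow> nat \<Rightarrow> real poly" where
  "type_II_poly p T 0 = 1"
| "type_II_poly p T (Suc n) =
     ([:0, 1:] - [:T n n:]) * type_II_poly p T n
     - (\<Sum>k\<in>{1..p}. if k \<le> n then Polynomial.smult (T n (n - k)) (type_II_poly p T (n - k)) else 0)"

text \<open>The library's \<^const>\<open>char_poly\<close> of \<open>A\<close> is \<open>det (x I - A)\<close>. It is 1 for the \<open>0 \<times> 0\<close>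
  matrix, as required for \<open>k = N + 1\<close>.\<close>

definition truncated_poly :: "(nat \<Rightarrow> nat \<Rightarrow> real) \<Rightarrow> nat \<Rightarrow> nat \<Rightarrow> real poly" where
  "truncated_poly T N k = char_poly (trunc_mat T N k)"

lemma truncated_poly_last: "truncated_poly T N (N + 1) = 1"
  by (simp add: truncated_poly_def trunc_mat_def char_poly_def char_poly_matrix_def det_dim_zero)

lemma poly_truncated_poly:
  "poly (truncated_poly T N k) x = det (x \<cdot>\<^sub>m 1\<^sub>m (N + 1 - k) - trunc_mat T N k)"
proof -
  have "poly (truncated_poly T N k) x = det (- char_matrix (trunc_mat T N k) x)"
    unfolding truncated_poly_def
    by (rule char_poly_matrix[of _ "N + 1 - k"]) (simp add: trunc_mat_def)
  also have "- char_matrix (trunc_mat T N k) x = x \<cdot>\<^sub>m 1\<^sub>m (N + 1 - k) - trunc_mat T N k"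
    by (intro eq_matI) (auto simp: char_matrix_def trunc_mat_def)
  finally show ?thesis .
qed


section \<open>The finite stochastic matrices\<close>

definition pi_II :: "nat \<Rightarrow> (nat \<Rightarrow> nat \<Rightarrow> real) \<Rightarrow> nat \<Rightarrow> nat \<Rightarrow> real" where
  "pi_II p T N n = 1 / poly (type_II_poly p T n) (largest_eigenvalue T N)"

definition pi_I :: "(nat \<Rightarrow> nat \<Rightarrow> real) \<Rightarrow> nat \<Rightarrow> nat \<Rightarrow> real" where
  "pi_I T N n = poly (truncated_poly T N (n + 1)) (largest_eigenvalue T N) /
                poly (truncated_poly T N 1) (largest_eigenvalue T N)"

definition P_II :: "nat \<Rightarrow> (nat \<Rightarrow> nat \<Rightarrow> real) \<Rightarrow> nat \<Rightarrow> real mat" where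
  "P_II p T N =
     mat_diag (N + 1) (pi_II p T N)
     * (inverse (largest_eigenvalue T N) \<cdot>\<^sub>m trunc_mat T N 0)
     * mat_diag (N + 1) (\<lambda>n. inverse (pi_II p T N n))"

definition P_I :: "(nat \<Rightarrow> nat \<Rightarrow> real) \<Rightarrow> nat \<Rightarrow> real mat" where
  "P_I T N =
     mat_diag (N + 1) (\<lambda>n. inverse (pi_I T N n))
     * (inverse (largest_eigenvalue T N) \<cdot>\<^sub>m transpose_mat (trunc_mat T N 0))
     * mat_diag (N + 1) (pi_I T N)"


section \<open>Markov chains and recurrence\<close>

text \<open>\<open>chain_law S P i\<close> is the law, on the space of paths, of the Markov chain with state space
  \<open>S\<close> and transition matrix \<open>P\<close> started at \<open>i\<close>. It is obtained from the Ionescu-Tulcea extension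
  theorem applied to the initial law concentrated at \<open>i\<close> and the step kernels given by the rows of
  \<open>P\<close>. Its finite-dimensional distributions are computed in lemma \<open>chain_law_path\<close> below.\<close>

definition chain_step :: "'s set \<Rightarrow> ('s \<Rightarrow> 's \<Rightarrow> real) \<Rightarrow> 's \<Rightarrow> nat \<Rightarrow> (nat \<Rightarrow> 's) \<Rightarrow> 's measure" where
  "chain_step S P i n \<omega> =
     (if n = 0 then return (count_space S) i
      else point_measure S (\<lambda>j. ennreal (P (\<omega> (n - 1)) j)))"

definition chain_law :: "'s set \<Rightarrow> ('s \<Rightarrow> 's \<Rightarrow> real) \<Rightarrow> 's \<Rightarrow> (nat \<Rightarrow> 's) measure" where
  "chain_law S P i =
     projective_family.lim UNIV
       (Ionescu_Tulcea.CI (chain_step S P i) (\<lambda>_. count_space S)) (\<lambda>_. count_space S)"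

definition recurrent_state :: "'s set \<Rightarrow> ('s \<Rightarrow> 's \<Rightarrow> real) \<Rightarrow> 's \<Rightarrow> bool" where
  "recurrent_state S P i \<longleftrightarrow> \<P>(\<omega> in chain_law S P i. \<exists>n\<ge>1. \<omega> n = i) = 1"

text \<open>Stochasticity is part of what it means for \<open>P\<close> to be the transition matrix of a Markov chain;
  without it \<^const>\<open>chain_law\<close> would be meaningless.\<close>

definition recurrent_markov_chain :: "'s set \<Rightarrow> ('s \<Rightarrow> 's \<Rightarrow> real) \<Rightarrow> bool" where
  "recurrent_markov_chain S P \<longleftrightarrow> stochastic_on S P \<and> (\<forall>i\<in>S. recurrent_state S P i)"

context
  fixes S :: "'s set" and P :: "'s \<Rightarrow> 's \<Rightarrow> real" and i :: 's
  assumes fin: "finite S" and stoch: "stochastic_on S P" and i: "i \<in> S"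
begin

lemma prob_space_row:
  assumes "x \<in> S"
  shows "prob_space (point_measure S (\<lambda>j. ennreal (P x j)))"
proof
  have "(\<Sum>j\<in>S. ennreal (P x j)) = ennreal (\<Sum>j\<in>S. P x j)"
    using assms stoch by (intro sum_ennreal) (auto simp: stochastic_on_def)
  also have "(\<Sum>j\<in>S. P x j) = 1"
    using assms stoch fin by (auto simp: stochastic_on_def dest: has_sum_unique[OF has_sum_finite])
  finally show "emeasure (point_measure S (\<lambda>j. ennreal (P x j)))
      (space (point_measure S (\<lambda>j. ennreal (P x j)))) = 1"
    using fin by (simp add: space_point_measure emeasure_point_measure_finite)
qed

lemma prob_space_chain_step:
  assumes "\<omega> \<in> space (PiM {0..<n} (\<lambda>_. count_space S))"
  shows "prob_space (chain_step S P i n \<omega>)"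
proof (cases "n = 0")
  case True
  then show ?thesis using i by (simp add: chain_step_def prob_space_return)
next
  case False
  then have "\<omega> (n - 1) \<in> S" using assms by (auto simp: space_PiM PiE_iff)
  then show ?thesis using False prob_space_row by (simp add: chain_step_def)
qed

lemma measurable_chain_step:
  "chain_step S P i n \<in> measurable (PiM {0..<n} (\<lambda>_. count_space S)) (subprob_algebra (count_space S))"
proof (cases "n = 0")
  case True
  have "return (count_space S) i \<in> space (subprob_algebra (count_space S))"
    using i by (auto simp: space_subprob_algebra intro!: prob_space_imp_subprob_space prob_space_return)
  with True show ?thesis by (simp add: chain_step_def[abs_def])
next
  case False
  have "(\<lambda>x. point_measure S (\<lambda>j. ennreal (P x j)))
      \<in> measurable (count_space S) (subprob_algebra (count_space S))"
    by (auto simp: space_subprob_algebra sets_point_measure prob_space_row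
        intro: prob_space_imp_subprob_space)
  then have "(\<lambda>\<omega>. point_measure S (\<lambda>j. ennreal (P (\<omega> (n - 1)) j)))
      \<in> measurable (PiM {0..<n} (\<lambda>_. count_space S)) (subprob_algebra (count_space S))"
    using False
    by (intro measurable_compose[of "\<lambda>\<omega>. \<omega> (n - 1)", OF measurable_component_singleton]) auto
  then show ?thesis using False by (simp add: chain_step_def[abs_def])
qed

interpretation IT: Ionescu_Tulcea "chain_step S P i" "\<lambda>_. count_space S"
  by (rule Ionescu_Tulcea.intro[OF measurable_chain_step prob_space_chain_step])

lemma space_chain_law: "space (chain_law S P i) = space (PiM UNIV (\<lambda>_. count_space S))"
  unfolding chain_law_def by (rule IT.PF.space_lim)

lemma sets_chain_law: "sets (chain_law S P i) = sets (PiM UNIV (\<lambda>_. count_space S))"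
  unfolding chain_law_def by (rule IT.PF.sets_lim)

lemma prob_space_chain_law: "prob_space (chain_law S P i)"
proof
  have "emeasure (chain_law S P i) (IT.PF.emb UNIV {} (space (PiM {} (\<lambda>_. count_space S)))) =
      emeasure (IT.CI {}) (space (PiM {} (\<lambda>_. count_space S)))"
    unfolding chain_law_def by (rule IT.lim) auto
  also have "\<dots> = 1"
    using prob_space.emeasure_space_1[OF IT.PF.prob_space_P[of "{}"]] IT.PF.space_P[of "{}"] by simp
  also have "IT.PF.emb UNIV {} (space (PiM {} (\<lambda>_. count_space S))) = space (chain_law S P i)"
    by (auto simp: space_chain_law prod_emb_def space_PiM)
  finally show "emeasure (chain_law S P i) (space (chain_law S P i)) = 1" .
qed

lemma emeasure_C_path:
  assumes x: "\<And>m. x m \<in> S"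
  shows "emeasure (IT.C 0 (Suc n) (\<lambda>_. undefined)) {restrict x {0..<Suc n}} =
     (if x 0 = i then ennreal (\<Prod>m<n. P (x m) (x (Suc m))) else 0)"
proof -
  let ?M = "\<lambda>_::nat. count_space S"
  have sets: "{restrict x {0..<n}} \<in> sets (PiM {0..<n} ?M)" for n
  proof -
    have "{restrict x {0..<n}} = PiE {0..<n} (\<lambda>m. {x m})"
      by (auto simp: PiE_def extensional_def fun_eq_iff Pi_iff)
    also have "\<dots> \<in> sets (PiM {0..<n} ?M)"
      using x by (intro sets_PiM_I_finite) auto
    finally show ?thesis .
  qed
  have u: "(\<lambda>_. undefined) \<in> space (PiM {0..<0} ?M)"
    by (simp add: space_PiM)
  have step: "emeasure (IT.C 0 (Suc n) (\<lambda>_. undefined)) {restrict x {0..<Suc n}} =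
      emeasure (chain_step S P i n (restrict x {0..<n})) {x n} *
      emeasure (IT.C 0 n (\<lambda>_. undefined)) {restrict x {0..<n}}" for n
  proof -
    have space_C: "space (IT.C 0 n (\<lambda>_. undefined)) = space (PiM {0..<n} ?M)"
      using IT.space_C[OF u, of n] by simp
    have sets_C: "sets (IT.C 0 n (\<lambda>_. undefined)) = sets (PiM {0..<n} ?M)"
      using IT.sets_C[OF u, of n] by simp
    have eP: "emeasure (IT.eP n \<omega>) {restrict x {0..<Suc n}} =
        emeasure (chain_step S P i n (restrict x {0..<n})) {x n} * indicator {restrict x {0..<n}} \<omega>"
      if "\<omega> \<in> space (PiM {0..<n} ?M)" for \<omega>
    proof -
      have ext: "\<omega> \<in> extensional {0..<n}" using that by (auto simp: space_PiM PiE_def)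
      have iff: "fun_upd \<omega> n y = restrict x {0..<Suc n} \<longleftrightarrow> \<omega> = restrict x {0..<n} \<and> y = x n" for y
      proof
        assume *: "fun_upd \<omega> n y = restrict x {0..<Suc n}"
        have "y = x n" using fun_cong[OF *, of n] by simp
        moreover have "\<omega> m = restrict x {0..<n} m" for m
          using fun_cong[OF *, of m] ext by (cases "m < n") (auto simp: extensional_def)
        ultimately show "\<omega> = restrict x {0..<n} \<and> y = x n" by auto
      qed (auto simp: fun_eq_iff)
      have "fun_upd \<omega> n -` {restrict x {0..<Suc n}} \<inter> S =
          (if \<omega> = restrict x {0..<n} then {x n} else {})"
        using x iff by auto
      then show ?thesis
        using IT.emeasure_eP[OF that sets[of "Suc n"]] by (simp add: indicator_def)
    qed
    have "emeasure (IT.C 0 (Suc n) (\<lambda>_. undefined)) {restrict x {0..<Suc n}} =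
        (\<integral>\<^sup>+\<omega>. emeasure (IT.eP n \<omega>) {restrict x {0..<Suc n}} \<partial>IT.C 0 n (\<lambda>_. undefined))"
      unfolding IT.C.simps add_0
    proof (rule emeasure_bind)
      show "space (IT.C 0 n (\<lambda>_. undefined)) \<noteq> {}"
        using IT.prob_space_C[OF u] by (rule prob_space.not_empty)
      show "IT.eP n \<in> measurable (IT.C 0 n (\<lambda>_. undefined)) (subprob_algebra (PiM {0..<Suc n} ?M))"
        using IT.measurable_eP[of n] by (simp add: measurable_cong_sets[OF sets_C refl])
    qed (rule sets)
    also have "\<dots> = (\<integral>\<^sup>+\<omega>. emeasure (chain_step S P i n (restrict x {0..<n})) {x n} *
        indicator {restrict x {0..<n}} \<omega> \<partial>IT.C 0 n (\<lambda>_. undefined))"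
      by (intro nn_integral_cong) (simp add: space_C eP)
    also have "\<dots> = emeasure (chain_step S P i n (restrict x {0..<n})) {x n} *
        emeasure (IT.C 0 n (\<lambda>_. undefined)) {restrict x {0..<n}}"
      by (intro nn_integral_cmult_indicator) (simp add: sets_C sets)
    finally show ?thesis .
  qed
  show ?thesis
  proof (induction n)
    case 0
    have "emeasure (IT.C 0 0 (\<lambda>_. undefined)) {restrict x {0..<0}} = 1"
      using sets[of 0] by (simp add: emeasure_return restrict_def)
    moreover have "emeasure (chain_step S P i 0 (restrict x {0..<0})) {x 0} = (if x 0 = i then 1 else 0)"
      using x by (auto simp: chain_step_def emeasure_return)
    ultimately show ?case
      by (simp only: step[of 0]) simp
  next
    case (Suc n)
    have nn: "P (x m) (x (Suc m)) \<ge> 0" for m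
      using stoch x by (auto simp: stochastic_on_def)
    have row: "emeasure (chain_step S P i (Suc n) (restrict x {0..<Suc n})) {x (Suc n)} =
        ennreal (P (x n) (x (Suc n)))"
      using x fin by (simp add: chain_step_def emeasure_point_measure_finite)
    show ?case
      unfolding step[of "Suc n"] row Suc.IH
      using nn by (auto simp: ennreal_mult prod_nonneg mult.commute)
  qed
qed

text \<open>The coordinate process under \<^term>\<open>chain_law S P i\<close> is a Markov chain with transition matrix
  \<open>P\<close> started at \<open>i\<close>.\<close>

lemma chain_law_path:
  assumes x: "\<And>m. x m \<in> S"
  shows "\<P>(\<omega> in chain_law S P i. \<forall>m\<le>n. \<omega> m = x m) =
     (if x 0 = i then \<Prod>m<n. P (x m) (x (Suc m)) else 0)"
proof -
  let ?M = "\<lambda>_::nat. count_space S"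
  have s: "{restrict x {0..<Suc n}} = PiE {0..<Suc n} (\<lambda>m. {x m})"
    by (auto simp: PiE_def extensional_def fun_eq_iff Pi_iff)
  have sets: "{restrict x {0..<Suc n}} \<in> sets (PiM {0..<Suc n} ?M)"
    unfolding s using x by (intro sets_PiM_I_finite) auto
  have emb: "{\<omega> \<in> space (chain_law S P i). \<forall>m\<le>n. \<omega> m = x m} =
      IT.PF.emb UNIV {0..<Suc n} {restrict x {0..<Suc n}}"
    by (auto simp: space_chain_law prod_emb_def space_PiM fun_eq_iff restrict_def less_Suc_eq_le) metis
  have "emeasure (chain_law S P i) (IT.PF.emb UNIV {0..<Suc n} {restrict x {0..<Suc n}}) =
      emeasure (IT.CI {0..<Suc n}) {restrict x {0..<Suc n}}"
    unfolding chain_law_def by (rule IT.lim[OF _ sets]) simp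
  also have "\<dots> = emeasure (IT.C 0 (Suc n) (\<lambda>_. undefined))
      (IT.PF.emb {0..<Suc n} {0..<Suc n} {restrict x {0..<Suc n}})"
    by (rule IT.emeasure_CI[OF order_refl sets])
  also have "IT.PF.emb {0..<Suc n} {0..<Suc n} {restrict x {0..<Suc n}} = {restrict x {0..<Suc n}}"
    using sets.sets_into_space[OF sets] by (intro prod_emb_id) (simp add: space_PiM)
  also have "emeasure (IT.C 0 (Suc n) (\<lambda>_. undefined)) {restrict x {0..<Suc n}} =
     (if x 0 = i then ennreal (\<Prod>m<n. P (x m) (x (Suc m))) else 0)"
    by (rule emeasure_C_path[OF x])
  finally have "emeasure (chain_law S P i) {\<omega> \<in> space (chain_law S P i). \<forall>m\<le>n. \<omega> m = x m} =
     (if x 0 = i then ennreal (\<Prod>m<n. P (x m) (x (Suc m))) else 0)"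
    unfolding emb .
  moreover have "(\<Prod>m<n. P (x m) (x (Suc m))) \<ge> 0"
    using stoch x by (intro prod_nonneg) (auto simp: stochastic_on_def)
  ultimately show ?thesis
    by (auto simp: measure_def)
qed

end

end

theory Submission
  imports Defs
begin

text \<open>A finite chain is recurrent as soon as its transition matrix is stochastic and irreducible. So the
  work is to see that both matrices are of the form \<open>A i j * v j / (\<lambda> * v i)\<close>, where \<open>A\<close> is
  \<open>T\<close> restricted to \<open>{0..N}\<close> or its transpose, \<open>\<lambda>\<close> is the largest eigenvalue and \<open>v\<close> is a
  positive eigenvector of \<open>A\<close> for \<open>\<lambda>\<close>. The rows then sum to 1 by the eigenvector equation. The
  bidiagonal factorization makes \<open>T\<close> nonnegative, with \<open>T 0 0\<close> and the subdiagonal positive; with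
  the unit superdiagonal this lets the chain move between neighbouring states, which gives
  irreducibility (\<open>recurrent_doob_transform\<close>).

  The eigenvectors come from polynomials generated by a Hessenberg recurrence
  \<open>b (n + 1) = (x - c n n) b n - (\<Sum>m<n. c n m b m)\<close> with \<open>b 0 = 1\<close>. For \<open>c = T\<close> these are the type
  II polynomials. For the matrix \<open>c n m = T (N - m) (N - n)\<close>, the reflection of \<open>T\<close> in its
  antidiagonal, they are the truncated polynomials \<open>b n = B\<^bsup>[N+1-n]\<^esup>\<close>; this is an identity of
  determinants (\<open>truncated_poly_recurrence\<close>). At a root of \<open>b (N + 1)\<close> the recurrence says that the
  values of \<open>b 0, \<dots>, b N\<close> form an eigenvector (\<open>hessenberg_poly_eigen\<close>), and at the largest root
  they are all positive, because the largest roots of \<open>b 1, b 2, \<dots>\<close> increase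
  (\<open>hessenberg_poly_largest_root\<close>). This plays the part of the Perron--Frobenius theorem.

  One recurrence thus yields a positive right eigenvector and, after the reflection, a positive left
  eigenvector of \<open>T\<close>. Their eigenvalues agree, since the two vectors have a positive pairing
  (\<open>positive_left_right_eigenvalue_eq\<close>). The second one is the largest root of the
  characteristic polynomial, hence the largest eigenvalue.\<close>

section \<open>Recurrence of finite irreducible chains\<close>

text \<open>The probability that the chain started at \<open>s\<close> stays away from \<open>i\<close> during the steps
  \<open>1, \<dots>, k\<close>, obtained by conditioning on the first step.\<close>

primrec avoid_prob :: "'s set \<Rightarrow> ('s \<Rightarrow> 's \<Rightarrow> real) \<Rightarrow> 's \<Rightarrow> nat \<Rightarrow> 's \<Rightarrow> real" where
  "avoid_prob S P i 0 s = 1"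
| "avoid_prob S P i (Suc k) s = (\<Sum>j\<in>S - {i}. P s j * avoid_prob S P i k j)"

text \<open>The prescribed initial path makes the induction on \<open>k\<close> work: splitting the event according to the
  state at time \<open>n + 1\<close> gives events of the same kind with a path that is one step longer, and
  the base case is the formula for the finite-dimensional distributions.\<close>

lemma prob_path_then_avoid:
  assumes fin: "finite S" and stoch: "stochastic_on S P" and i: "i \<in> S"
    and "\<And>m. x m \<in> S" and "x 0 = i"
  shows "\<P>(\<omega> in chain_law S P i. (\<forall>m\<le>n. \<omega> m = x m) \<and> (\<forall>m\<in>{n<..n + k}. \<omega> m \<noteq> i)) =
    (\<Prod>m<n. P (x m) (x (Suc m))) * avoid_prob S P i k (x n)"
  using assms(4,5)
proof (induction k arbitrary: n x)
  case 0
  then show ?case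
    using chain_law_path[OF fin stoch i, of x n] by simp
next
  case (Suc k)
  let ?M = "chain_law S P i"
  interpret prob_space ?M
    by (rule prob_space_chain_law[OF fin stoch i])
  define E where "E j = {\<omega> \<in> space ?M. (\<forall>m\<le>Suc n. \<omega> m = (x(Suc n := j)) m) \<and>
    (\<forall>m\<in>{Suc n<..Suc n + k}. \<omega> m \<noteq> i)}" for j
  have comp: "(\<lambda>\<omega>. \<omega> m) \<in> measurable ?M (count_space S)" for m :: nat
    by (simp add: measurable_cong_sets[OF sets_chain_law[OF fin stoch i] refl])
  have sets: "E j \<in> events" for j
    unfolding E_def using comp by measurable
  have inS: "\<omega> m \<in> S" if "\<omega> \<in> space ?M" for \<omega> m
    using that by (auto simp: space_chain_law[OF fin stoch i] space_PiM)
  have union: "{\<omega> \<in> space ?M. (\<forall>m\<le>n. \<omega> m = x m) \<and> (\<forall>m\<in>{n<..n + Suc k}. \<omega> m \<noteq> i)} =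
      (\<Union>j\<in>S - {i}. E j)"
  proof (intro Set.set_eqI iffI)
    fix \<omega> assume \<omega>: "\<omega> \<in> {\<omega> \<in> space ?M. (\<forall>m\<le>n. \<omega> m = x m) \<and> (\<forall>m\<in>{n<..n + Suc k}. \<omega> m \<noteq> i)}"
    then have "\<omega> \<in> E (\<omega> (Suc n))"
      by (auto simp: E_def le_Suc_eq)
    moreover have "\<omega> (Suc n) \<in> S - {i}"
      using \<omega> inS by auto
    ultimately show "\<omega> \<in> (\<Union>j\<in>S - {i}. E j)"
      by blast
  next
    fix \<omega> assume "\<omega> \<in> (\<Union>j\<in>S - {i}. E j)"
    then obtain j where j: "j \<in> S - {i}" "\<omega> \<in> E j"
      by blast
    have "\<omega> m \<noteq> i" if "m \<in> {n<..n + Suc k}" for m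
      using j that by (cases "m = Suc n") (auto simp: E_def)
    moreover have "\<omega> m = x m" if "m \<le> n" for m
      using j that by (auto simp: E_def dest: spec[of _ m])
    ultimately show "\<omega> \<in> {\<omega> \<in> space ?M. (\<forall>m\<le>n. \<omega> m = x m) \<and> (\<forall>m\<in>{n<..n + Suc k}. \<omega> m \<noteq> i)}"
      using j by (auto simp: E_def)
  qed
  have "prob (\<Union>j\<in>S - {i}. E j) = (\<Sum>j\<in>S - {i}. prob (E j))"
  proof (rule finite_measure_finite_Union)
    show "disjoint_family_on E (S - {i})"
      unfolding disjoint_family_on_def E_def by (auto dest!: spec[of _ "Suc n"])
  qed (use fin sets in auto)
  also have "\<dots> = (\<Sum>j\<in>S - {i}. (\<Prod>m<n. P (x m) (x (Suc m))) * (P (x n) j * avoid_prob S P i k j))"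
  proof (rule sum.cong[OF refl])
    fix j assume j: "j \<in> S - {i}"
    have "prob (E j) = (\<Prod>m<Suc n. P ((x(Suc n := j)) m) ((x(Suc n := j)) (Suc m))) *
        avoid_prob S P i k ((x(Suc n := j)) (Suc n))"
      unfolding E_def using Suc.prems j by (intro Suc.IH) auto
    then show "prob (E j) = (\<Prod>m<n. P (x m) (x (Suc m))) * (P (x n) j * avoid_prob S P i k j)"
      by simp
  qed
  finally show ?case
    unfolding union by (simp add: sum_distrib_left)
qed

text \<open>The avoidance probabilities decrease in \<open>k\<close>. Their limit is harmonic for the chain killed at \<open>i\<close>,
  so a positive maximum would spread to everything that is reachable and could never meet \<open>i\<close>.\<close>

lemma avoid_prob_tendsto_0:
  assumes fin: "finite S" and stoch: "stochastic_on S P" and i: "i \<in> S"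
    and reach: "\<And>s. s \<in> S \<Longrightarrow> (s, i) \<in> {(a, b). a \<in> S \<and> b \<in> S \<and> P a b > 0}\<^sup>+"
    and s: "s \<in> S"
  shows "(\<lambda>k. avoid_prob S P i k s) \<longlonglongrightarrow> 0"
proof -
  let ?a = "avoid_prob S P i"
  have nn: "P u v \<ge> 0" if "u \<in> S" "v \<in> S" for u v
    using stoch that by (auto simp: stochastic_on_def)
  have row: "(\<Sum>v\<in>S. P u v) = 1" if "u \<in> S" for u
    using stoch that fin by (auto simp: stochastic_on_def dest: has_sum_unique[OF has_sum_finite])
  have row': "(\<Sum>v\<in>S - {i}. P u v) = 1 - P u i" if "u \<in> S" for u
    using row[OF that] fin i by (simp add: sum_diff1)
  have a_nn: "?a k u \<ge> 0" if "u \<in> S" for k u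
    using that by (induction k arbitrary: u) (auto intro!: sum_nonneg mult_nonneg_nonneg nn)
  have a_dec: "?a (Suc k) u \<le> ?a k u" if "u \<in> S" for k u
    using that
  proof (induction k arbitrary: u)
    case 0
    then show ?case using row'[OF 0] nn[OF 0 i] by simp
  next
    case (Suc k)
    show ?case
      unfolding avoid_prob.simps(2)[of _ _ _ "Suc k"] avoid_prob.simps(2)[of _ _ _ k]
      using Suc by (intro sum_mono mult_left_mono nn) auto
  qed
  have "\<exists>l. (\<lambda>k. ?a k u) \<longlonglongrightarrow> l" if "u \<in> S" for u
  proof -
    have "decseq (\<lambda>k. ?a k u)"
      using a_dec[OF that] by (rule decseq_SucI)
    then show ?thesis
      using decseq_convergent[of "\<lambda>k. ?a k u" 0] a_nn[OF that] by blast
  qed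
  then obtain l where l: "\<And>u. u \<in> S \<Longrightarrow> (\<lambda>k. ?a k u) \<longlonglongrightarrow> l u"
    by metis
  have l_nn: "l u \<ge> 0" if "u \<in> S" for u
    using LIMSEQ_le_const[OF l[OF that]] a_nn[OF that] by blast
  have harmonic: "l u = (\<Sum>v\<in>S - {i}. P u v * l v)" if "u \<in> S" for u
  proof (rule LIMSEQ_unique)
    show "(\<lambda>k. ?a (Suc k) u) \<longlonglongrightarrow> l u"
      by (rule LIMSEQ_Suc[OF l[OF that]])
    show "(\<lambda>k. ?a (Suc k) u) \<longlonglongrightarrow> (\<Sum>v\<in>S - {i}. P u v * l v)"
      unfolding avoid_prob.simps(2) by (intro tendsto_intros l) auto
  qed
  define M where "M = Max (l ` S)"
  have le_M: "l u \<le> M" if "u \<in> S" for u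
    using that fin by (simp add: M_def)
  have "M \<in> l ` S"
    using fin s unfolding M_def by (intro Max_in) auto
  then obtain w where w: "w \<in> S" "l w = M"
    by auto
  have "M = 0"
  proof (rule ccontr)
    assume "M \<noteq> 0"
    then have M: "M > 0"
      using l_nn[OF w(1)] w(2) by simp
    (* the weights P u v over v in S sum to 1, so averaging l over S - {i} can only give M if no
       mass is lost to i and no successor lies below M *)
    have succ: "l v = M \<and> v \<noteq> i" if u: "u \<in> S" "l u = M" and v: "v \<in> S" "P u v > 0" for u v
    proof -
      have "P u i * M + (\<Sum>v\<in>S - {i}. P u v * (M - l v)) = 
          P u i * M + (\<Sum>v\<in>S - {i}. P u v) * M - (\<Sum>v\<in>S - {i}. P u v * l v)"
        by (simp add: right_diff_distrib sum_subtractf sum_distrib_right)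
      also have "\<dots> = 0"
        unfolding row'[OF u(1)] harmonic[OF u(1), symmetric] u(2) by (simp add: algebra_simps)
      finally have zero: "P u i * M + (\<Sum>v\<in>S - {i}. P u v * (M - l v)) = 0" .
      have ge: "P u v * (M - l v) \<ge> 0" if "v \<in> S - {i}" for v
        using that nn[OF u(1)] le_M by simp
      have "(\<Sum>v\<in>S - {i}. P u v * (M - l v)) \<ge> 0" "P u i * M \<ge> 0"
        using ge nn[OF u(1) i] M by (auto intro: sum_nonneg)
      then have z: "P u i * M = 0" "(\<Sum>v\<in>S - {i}. P u v * (M - l v)) = 0"
        using zero by linarith+
      have "v \<noteq> i"
        using z(1) M v by auto
      moreover have "\<forall>v\<in>S - {i}. P u v * (M - l v) = 0"
        using z(2) ge fin by (subst (asm) sum_nonneg_eq_0_iff) auto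
      ultimately have "P u v * (M - l v) = 0"
        using v(1) by blast
      then show ?thesis
        using v(2) \<open>v \<noteq> i\<close> by simp
    qed
    have "l v = M \<and> v \<noteq> i" if "(w, v) \<in> {(a, b). a \<in> S \<and> b \<in> S \<and> P a b > 0}\<^sup>+" for v
      using that
    proof (induction rule: trancl_induct)
      case (base y)
      then show ?case using succ[OF w] by auto
    next
      case (step y z)
      then show ?case using succ by auto
    qed
    then show False
      using reach[OF w(1)] by blast
  qed
  then have "l s = 0"
    using le_M[OF s] l_nn[OF s] by simp
  then show ?thesis
    using l[OF s] by simp
qed

lemma finite_irreducible_recurrent:
  assumes fin: "finite S" and stoch: "stochastic_on S P"
    and irred: "\<And>s i. s \<in> S \<Longrightarrow> i \<in> S \<Longrightarrow> (s, i) \<in> {(a, b). a \<in> S \<and> b \<in> S \<and> P a b > 0}\<^sup>+"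
  shows "recurrent_markov_chain S P"
proof -
  have "recurrent_state S P i" if i: "i \<in> S" for i
  proof -
    let ?M = "chain_law S P i"
    interpret prob_space ?M
      by (rule prob_space_chain_law[OF fin stoch i])
    have comp: "(\<lambda>\<omega>. \<omega> m) \<in> measurable ?M (count_space S)" for m :: nat
      by (simp add: measurable_cong_sets[OF sets_chain_law[OF fin stoch i] refl])
    have meas: "{\<omega> \<in> space ?M. \<exists>n\<ge>1. \<omega> n = i} \<in> events"
      using comp by measurable
    have "1 - prob {\<omega> \<in> space ?M. \<exists>n\<ge>1. \<omega> n = i} \<le> avoid_prob S P i k i" for k
    proof -
      have "AE \<omega> in ?M. \<omega> 0 = i"
      proof (subst prob_Collect_eq_1[symmetric])
        show "{\<omega> \<in> space ?M. \<omega> 0 = i} \<in> events"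
          using comp by measurable
        show "prob {\<omega> \<in> space ?M. \<omega> 0 = i} = 1"
          using chain_law_path[OF fin stoch i, of "\<lambda>_. i" 0] i by simp
      qed
      have "1 - prob {\<omega> \<in> space ?M. \<exists>n\<ge>1. \<omega> n = i} = prob {\<omega> \<in> space ?M. \<not> (\<exists>n\<ge>1. \<omega> n = i)}"
        using prob_neg[OF meas] by simp
      also have "\<dots> \<le> prob {\<omega> \<in> space ?M. (\<forall>m\<le>0. \<omega> m = (\<lambda>_. i) m) \<and> (\<forall>m\<in>{0<..0 + k}. \<omega> m \<noteq> i)}"
      proof (rule finite_measure_mono_AE)
        show "{\<omega> \<in> space ?M. (\<forall>m\<le>0. \<omega> m = (\<lambda>_. i) m) \<and> (\<forall>m\<in>{0<..0 + k}. \<omega> m \<noteq> i)} \<in> events"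
          using comp by measurable
      qed (use \<open>AE \<omega> in ?M. \<omega> 0 = i\<close> in \<open>auto elim!: eventually_mono\<close>)
      also have "\<dots> = avoid_prob S P i k i"
        using prob_path_then_avoid[OF fin stoch i, of "\<lambda>_. i" 0 k] i by simp
      finally show ?thesis .
    qed
    then have "1 - prob {\<omega> \<in> space ?M. \<exists>n\<ge>1. \<omega> n = i} \<le> 0"
      by (intro LIMSEQ_le_const[OF avoid_prob_tendsto_0[OF fin stoch i irred[OF _ i] i]]) auto
    then have "prob {\<omega> \<in> space ?M. \<exists>n\<ge>1. \<omega> n = i} = 1"
      using prob_le_1[of "{\<omega> \<in> space ?M. \<exists>n\<ge>1. \<omega> n = i}"] by linarith
    then show ?thesis
      by (simp add: recurrent_state_def)
  qed
  with stoch show ?thesis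
    by (simp add: recurrent_markov_chain_def)
qed

section \<open>Polynomials of a Hessenberg recurrence\<close>

lemma hessenberg_poly_monic:
  fixes c :: "nat \<Rightarrow> nat \<Rightarrow> real" and b :: "nat \<Rightarrow> real poly"
  assumes b0: "b 0 = 1"
    and rec: "\<And>n. n \<le> N \<Longrightarrow>
      b (Suc n) = [:- c n n, 1:] * b n - (\<Sum>m<n. Polynomial.smult (c n m) (b m))"
    and n: "n \<le> Suc N"
  shows "degree (b n) = n \<and> lead_coeff (b n) = 1"
  using n
proof (induction n rule: less_induct)
  case (less n)
  show ?case
  proof (cases n)
    case 0
    then show ?thesis using b0 by simp
  next
    case (Suc k)
    let ?p = "[:- c k k, 1:] * b k" and ?q = "\<Sum>m<k. Polynomial.smult (c k m) (b m)"
    have k: "degree (b k) = k" "lead_coeff (b k) = 1"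
      using less.IH[of k] less.prems Suc by auto
    have p0: "b k \<noteq> 0"
      using k by auto
    have deg_p: "degree ?p = Suc k"
      using p0 k(1) by (subst degree_mult_eq) simp_all
    have lc_p: "lead_coeff ?p = 1"
      using k(2) by (subst lead_coeff_mult) simp
    have "degree ?q < Suc k"
    proof (rule degree_sum_less)
      fix m assume "m \<in> {..<k}"
      then have "degree (b m) = m" "m < k"
        using less Suc by auto
      then show "degree (Polynomial.smult (c k m) (b m)) < Suc k"
        using degree_smult_le[of "c k m" "b m"] by linarith
    qed simp
    then have q: "degree (- ?q) < degree ?p" "coeff ?q (Suc k) = 0"
      using deg_p by (simp, intro coeff_eq_0)
    have "b n = ?p + - ?q"
      using rec[of k] less.prems Suc by simp
    moreover have "degree (?p + - ?q) = Suc k"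
      using degree_add_eq_left[OF q(1)] deg_p by simp
    moreover have "coeff (?p + - ?q) (Suc k) = 1"
      using lc_p q(2) by (simp only: coeff_add coeff_minus deg_p)
    ultimately show ?thesis
      using Suc by simp
  qed
qed

lemma monic_largest_root:
  fixes f :: "real poly"
  assumes monic: "lead_coeff f > 0" and y: "poly f y \<le> 0"
  obtains \<mu> where "\<mu> \<ge> y" "poly f \<mu> = 0" "\<And>x. x > \<mu> \<Longrightarrow> poly f x > 0"
proof -
  have f0: "f \<noteq> 0"
    using monic by auto
  obtain K where K: "\<And>x. x \<ge> K \<Longrightarrow> poly f x > 0"
    using poly_pinfty_gt_lc[OF monic] monic by (meson less_le_trans)
  let ?R = "{x. poly f x = 0}"
  have fin: "finite ?R"
    using f0 by (rule poly_roots_finite)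
  have root_ge: "\<exists>r\<ge>x. poly f r = 0" if "poly f x \<le> 0" for x
  proof -
    have "poly f (max x K) \<ge> 0"
      using K[of "max x K"] by simp
    then have "\<exists>r. x \<le> r \<and> r \<le> max x K \<and> poly f r = 0"
      using that by (intro IVT) auto
    then show ?thesis by blast
  qed
  have ne: "?R \<noteq> {}"
    using root_ge[OF y] by blast
  show ?thesis
  proof (rule that[of "Max ?R"])
    obtain r where "r \<ge> y" "r \<in> ?R"
      using root_ge[OF y] by blast
    then show "Max ?R \<ge> y"
      using Max_ge[OF fin, of r] by linarith
    show "poly f (Max ?R) = 0"
      using Max_in[OF fin ne] by simp
    show "poly f x > 0" if "x > Max ?R" for x
    proof (rule ccontr)
      assume "\<not> poly f x > 0"
      then obtain r where "r \<ge> x" "r \<in> ?R"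
        using root_ge[of x] by auto
      then show False
        using Max_ge[OF fin, of r] that by linarith
    qed
  qed
qed

text \<open>At the largest root \<open>\<mu>\<close> of \<open>b (n + 1)\<close> the leading term of the recurrence for \<open>b (n + 2)\<close>
  vanishes, and what remains is minus a sum of nonnegative terms, one of them positive. So
  \<open>b (n + 2)\<close> is negative at \<open>\<mu>\<close>, and being monic it has a root beyond \<open>\<mu>\<close>. Hence the largest roots
  increase, and beyond the last one all earlier polynomials are positive.\<close>

lemma hessenberg_poly_largest_root:
  fixes c :: "nat \<Rightarrow> nat \<Rightarrow> real" and b :: "nat \<Rightarrow> real poly"
  assumes b0: "b 0 = 1"
    and rec: "\<And>n. n \<le> N \<Longrightarrow>
      b (Suc n) = [:- c n n, 1:] * b n - (\<Sum>m<n. Polynomial.smult (c n m) (b m))"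
    and nn: "\<And>n m. m < n \<Longrightarrow> n \<le> N \<Longrightarrow> c n m \<ge> 0"
    and sub: "\<And>n. n < N \<Longrightarrow> c (Suc n) n > 0"
  shows "\<exists>\<mu>\<ge>c 0 0. poly (b (Suc N)) \<mu> = 0 \<and> (\<forall>x>\<mu>. poly (b (Suc N)) x > 0) \<and>
    (\<forall>n\<le>N. poly (b n) \<mu> > 0)"
proof -
  have "\<exists>\<mu>\<ge>c 0 0. poly (b (Suc M)) \<mu> = 0 \<and> (\<forall>x>\<mu>. poly (b (Suc M)) x > 0) \<and>
    (\<forall>n\<le>M. \<forall>x\<ge>\<mu>. poly (b n) x > 0)" if "M \<le> N" for M
    using that
  proof (induction M)
    case 0
    have "b 1 = [:- c 0 0, 1:]"
      using rec[of 0] b0 by simp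
    then show ?case
      using b0 by (intro exI[of _ "c 0 0"]) auto
  next
    case (Suc M)
    then obtain \<mu> where \<mu>: "\<mu> \<ge> c 0 0" "poly (b (Suc M)) \<mu> = 0" "\<And>x. x > \<mu> \<Longrightarrow> poly (b (Suc M)) x > 0"
      "\<And>n x. n \<le> M \<Longrightarrow> x \<ge> \<mu> \<Longrightarrow> poly (b n) x > 0"
      by auto
    have val: "poly (b (Suc (Suc M))) \<mu> = - (\<Sum>m<Suc M. c (Suc M) m * poly (b m) \<mu>)"
      using rec[OF Suc.prems] \<mu>(2) by (simp add: poly_sum)
    have "(\<Sum>m<Suc M. c (Suc M) m * poly (b m) \<mu>) > 0"
    proof (rule sum_pos2[of _ M])
      show "0 < c (Suc M) M * poly (b M) \<mu>"
        using sub[of M] Suc.prems \<mu>(4)[of M \<mu>] by simp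
      show "0 \<le> c (Suc M) m * poly (b m) \<mu>" if "m \<in> {..<Suc M}" for m
        using nn[of m "Suc M"] Suc.prems \<mu>(4)[of m \<mu>] that by simp
    qed auto
    with val have neg: "poly (b (Suc (Suc M))) \<mu> < 0"
      by linarith
    have "lead_coeff (b (Suc (Suc M))) = 1"
      using hessenberg_poly_monic[of b N c "Suc (Suc M)", OF b0 rec] Suc.prems by blast
    then have "lead_coeff (b (Suc (Suc M))) > 0"
      by (simp only: zero_less_one)
    from monic_largest_root[OF this less_imp_le[OF neg]] obtain \<nu>
      where \<nu>: "\<nu> \<ge> \<mu>" "poly (b (Suc (Suc M))) \<nu> = 0" "\<And>x. x > \<nu> \<Longrightarrow> poly (b (Suc (Suc M))) x > 0"
      by blast
    have "\<nu> > \<mu>"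
      using \<nu>(1,2) neg by (cases "\<nu> = \<mu>") auto
    then have "poly (b n) x > 0" if "n \<le> Suc M" "x \<ge> \<nu>" for n x
      using \<mu>(3)[of x] \<mu>(4)[of n x] that by (cases "n = Suc M") auto
    then show ?case
      using \<nu> \<mu>(1) by (intro exI[of _ \<nu>]) auto
  qed
  from this[of N] show ?thesis
    by auto
qed

text \<open>With a unit superdiagonal, row \<open>n < N\<close> of the eigenvector equation is the recurrence for
  \<open>b (n + 1)\<close>. In row \<open>N\<close> the term \<open>b (N + 1)\<close> has no matrix entry to go with, and it is absent
  exactly at the roots.\<close>

lemma hessenberg_poly_eigen:
  fixes c :: "nat \<Rightarrow> nat \<Rightarrow> real" and b :: "nat \<Rightarrow> real poly"
  assumes rec: "\<And>n. n \<le> N \<Longrightarrow>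
      b (Suc n) = [:- c n n, 1:] * b n - (\<Sum>m<n. Polynomial.smult (c n m) (b m))"
    and super: "\<And>n. n < N \<Longrightarrow> c n (Suc n) = 1"
    and zero: "\<And>n m. Suc n < m \<Longrightarrow> m \<le> N \<Longrightarrow> c n m = 0"
    and root: "poly (b (Suc N)) x = 0" and n: "n \<le> N"
  shows "(\<Sum>m\<le>N. c n m * poly (b m) x) = x * poly (b n) x"
proof -
  let ?f = "\<lambda>m. c n m * poly (b m) x"
  have *: "(\<Sum>m<n. ?f m) + ?f n + poly (b (Suc n)) x = x * poly (b n) x"
    using arg_cong[OF rec[OF n], of "\<lambda>f. poly f x"] by (simp add: poly_sum algebra_simps)
  show ?thesis
  proof (cases "n = N")
    case True
    then show ?thesis
      using * root by (simp flip: lessThan_Suc_atMost)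
  next
    case False
    then have "n < N"
      using n by simp
    have "(\<Sum>m\<le>N. ?f m) = (\<Sum>m\<le>Suc n. ?f m)"
      using zero[of n] \<open>n < N\<close> by (intro sum.mono_neutral_right) auto
    also have "\<dots> = (\<Sum>m<n. ?f m) + ?f n + poly (b (Suc n)) x"
      using super[OF \<open>n < N\<close>] by (simp flip: lessThan_Suc_atMost)
    finally show ?thesis
      using * by simp
  qed
qed

section \<open>Truncated polynomials\<close>

text \<open>The relation says that the row vector \<open>q\<close> satisfies \<open>q M = (d, 0, \<dots>, 0)\<close>. Multiplying by the
  adjugate gives \<open>det M * q n = d * cofactor M n 0\<close>, and the cofactor is 1: deleting the last row and
  the first column leaves a lower triangular matrix with diagonal \<open>-1\<close>, whose sign cancels against
  that of the cofactor.\<close>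

lemma det_hessenberg_left_relation:
  fixes M :: "real mat" and q :: "nat \<Rightarrow> real"
  assumes M: "M \<in> carrier_mat (Suc n) (Suc n)"
    and super: "\<And>i. i < n \<Longrightarrow> M $$ (i, Suc i) = - 1"
    and zero: "\<And>i j. Suc i < j \<Longrightarrow> j \<le> n \<Longrightarrow> M $$ (i, j) = 0"
    and q_last: "q n = 1"
    and rel: "\<And>j. 0 < j \<Longrightarrow> j \<le> n \<Longrightarrow> (\<Sum>i\<le>n. q i * M $$ (i, j)) = 0"
  shows "det M = (\<Sum>i\<le>n. q i * M $$ (i, 0))"
proof -
  let ?D = "mat_delete M n 0"
  have D: "?D \<in> carrier_mat n n"
    using mat_delete_carrier[OF M] by simp
  have D_eq: "?D $$ (i, j) = M $$ (i, Suc j)" if "i < n" "j < n" for i j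
    using that M by (auto simp: mat_delete_def)
  have "det ?D = prod_list (diag_mat ?D)"
    using D D_eq zero by (intro det_lower_triangular[of n]) auto
  also have "diag_mat ?D = replicate n (- 1)"
    using D D_eq super by (intro nth_equalityI) (auto simp: diag_mat_def)
  finally have "det ?D = (- 1) ^ n"
    by simp
  then have cof: "cofactor M n 0 = 1"
    by (simp add: cofactor_def flip: power_add)
  let ?A = "adj_mat M"
  have A: "?A \<in> carrier_mat (Suc n) (Suc n)" "M * ?A = det M \<cdot>\<^sub>m 1\<^sub>m (Suc n)"
    using adj_mat[OF M] by auto
  have MA: "(\<Sum>j\<le>n. M $$ (i, j) * ?A $$ (j, n)) = (if i = n then det M else 0)" if "i \<le> n" for i
  proof -
    have "(M * ?A) $$ (i, n) = (\<Sum>j\<le>n. M $$ (i, j) * ?A $$ (j, n))"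
      using M A(1) that by (simp add: scalar_prod_def atLeast0LessThan lessThan_Suc_atMost)
    moreover have "(M * ?A) $$ (i, n) = (if i = n then det M else 0)"
      unfolding A(2) using that by simp
    ultimately show ?thesis
      by argo
  qed
  have "det M = (\<Sum>i\<le>n. q i * (\<Sum>j\<le>n. M $$ (i, j) * ?A $$ (j, n)))"
  proof -
    have "(\<Sum>i\<le>n. q i * (\<Sum>j\<le>n. M $$ (i, j) * ?A $$ (j, n))) = (\<Sum>i\<le>n. if i = n then det M else 0)"
      using MA q_last by (intro sum.cong) auto
    then show ?thesis
      by simp
  qed
  also have "\<dots> = (\<Sum>i\<le>n. \<Sum>j\<le>n. q i * M $$ (i, j) * ?A $$ (j, n))"
    by (simp add: sum_distrib_left mult.assoc)
  also have "\<dots> = (\<Sum>j\<le>n. (\<Sum>i\<le>n. q i * M $$ (i, j)) * ?A $$ (j, n))"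
    unfolding sum_distrib_right by (rule sum.swap)
  also have "\<dots> = (\<Sum>j\<in>{0}. (\<Sum>i\<le>n. q i * M $$ (i, j)) * ?A $$ (j, n))"
    using rel by (intro sum.mono_neutral_right) auto
  finally show ?thesis
    using M cof by (simp add: adj_mat_def)
qed

text \<open>In terms of \<open>k = N - n\<close>, this is the expansion of the determinant of the block with indices
  \<open>k, \<dots>, N\<close> along its first column. The recurrences of the smaller blocks say that the row vector
  \<open>q\<close> of the values \<open>B\<^bsup>[k+1]\<^esup>, \<dots>, B\<^bsup>[N+1]\<^esup>\<close> is orthogonal to all columns of the block of
  \<open>x I - T\<close> but the first, so the determinant equals the product of \<open>q\<close> with the first column.\<close>

lemma truncated_poly_recurrence:
  fixes T :: "nat \<Rightarrow> nat \<Rightarrow> real"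
  assumes super: "\<And>n. T n (Suc n) = 1" and zero: "\<And>n m. Suc n < m \<Longrightarrow> T n m = 0"
    and n: "n \<le> N"
  shows "truncated_poly T N (N - n) = [:- T (N - n) (N - n), 1:] * truncated_poly T N (Suc N - n) -
    (\<Sum>m<n. Polynomial.smult (T (N - m) (N - n)) (truncated_poly T N (Suc N - m)))"
  using n
proof (induction n rule: less_induct)
  case (less n)
  let ?k = "N - n"
  show ?case
  proof (rule poly_ext)
    fix x :: real
    define q where "q i = poly (truncated_poly T N (Suc (i + ?k))) x" for i
    define M where "M = x \<cdot>\<^sub>m 1\<^sub>m (Suc n) - trunc_mat T N ?k"
    have dim: "Suc N - ?k = Suc n"
      using less.prems by simp
    have M: "M \<in> carrier_mat (Suc n) (Suc n)"
      by (rule carrier_matI) (simp_all add: M_def trunc_mat_def dim)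
    have M_eq: "M $$ (i, j) = (if i = j then x else 0) - T (i + ?k) (j + ?k)" if "i \<le> n" "j \<le> n" for i j
      using that by (simp add: M_def trunc_mat_def dim)
    have qM: "(\<Sum>i\<le>n. q i * M $$ (i, j)) =
        x * q j - (\<Sum>m\<le>n. T (N - m) (j + ?k) * poly (truncated_poly T N (Suc N - m)) x)"
      if "j \<le> n" for j
    proof -
      have "(\<Sum>i\<le>n. q i * M $$ (i, j)) = (\<Sum>i\<le>n. (if i = j then x * q i else 0) - T (i + ?k) (j + ?k) * q i)"
        using that by (intro sum.cong) (auto simp: M_eq algebra_simps)
      also have "\<dots> = x * q j - (\<Sum>i\<le>n. T (i + ?k) (j + ?k) * q i)"
        using that by (simp add: sum_subtractf)
      also have "(\<Sum>i\<le>n. T (i + ?k) (j + ?k) * q i) =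
          (\<Sum>m\<le>n. T (N - m) (j + ?k) * poly (truncated_poly T N (Suc N - m)) x)"
        using less.prems
        by (intro sum.reindex_bij_witness[of _ "\<lambda>m. n - m" "\<lambda>m. n - m"]) (auto simp: q_def Suc_diff_le add.commute)
      finally show ?thesis .
    qed
    have "poly (truncated_poly T N ?k) x = det M"
      by (simp add: poly_truncated_poly M_def dim)
    also have "det M = (\<Sum>i\<le>n. q i * M $$ (i, 0))"
    proof (rule det_hessenberg_left_relation[OF M])
      show "M $$ (i, Suc i) = - 1" if "i < n" for i
        using that super by (simp add: M_eq)
      show "M $$ (i, j) = 0" if "Suc i < j" "j \<le> n" for i j
        using that zero by (simp add: M_eq)
      show "q n = 1"
        using less.prems truncated_poly_last[of T N] by (simp add: q_def)
      fix j assume j: "0 < j" "j \<le> n"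
      let ?m = "n - j"
      have idx: "N - ?m = j + ?k" "Suc N - ?m = Suc (j + ?k)" "j + ?k = Suc (N - Suc ?m)"
          "Suc N - Suc ?m = j + ?k" "Suc ?m \<le> n"
        using j less.prems by auto
      let ?f = "\<lambda>m. T (N - m) (j + ?k) * poly (truncated_poly T N (Suc N - m)) x"
      (* column j is orthogonal to q by the recurrence for the block that starts at index j + k;
         its polynomial enters with the superdiagonal entry 1 *)
      have "(\<Sum>m\<le>n. ?f m) = (\<Sum>m\<le>Suc ?m. ?f m)"
        using j less.prems by (intro sum.mono_neutral_right) (auto intro!: zero)
      also have "\<dots> = (\<Sum>m<?m. ?f m) + ?f ?m + ?f (Suc ?m)"
        by (simp flip: lessThan_Suc_atMost)
      also have "?f (Suc ?m) = poly (truncated_poly T N (N - ?m)) x"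
        using super[of "N - Suc ?m"] idx by simp
      also have "\<dots> = (x - T (j + ?k) (j + ?k)) * q j - (\<Sum>m<?m. ?f m)"
        using less.IH[of ?m] j less.prems by (simp add: idx q_def poly_sum left_diff_distrib)
      also have "?f ?m = T (j + ?k) (j + ?k) * q j"
        by (simp add: idx q_def)
      finally have "(\<Sum>m\<le>n. ?f m) = x * q j"
        by (simp add: algebra_simps)
      then show "(\<Sum>i\<le>n. q i * M $$ (i, j)) = 0"
        using qM[OF j(2)] by simp
    qed
    also have "\<dots> = x * q 0 - (\<Sum>m\<le>n. T (N - m) ?k * poly (truncated_poly T N (Suc N - m)) x)"
      using qM[of 0] by simp
    also have "\<dots> = poly ([:- T ?k ?k, 1:] * truncated_poly T N (Suc N - n) -
      (\<Sum>m<n. Polynomial.smult (T (N - m) ?k) (truncated_poly T N (Suc N - m)))) x"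
      using less.prems by (simp add: poly_sum q_def Suc_diff_le algebra_simps flip: lessThan_Suc_atMost)
    finally show "poly (truncated_poly T N ?k) x = \<dots>" .
  qed
qed

section \<open>Entries of the bidiagonal product\<close>

lemma smat_mult_lower_bidiagonal:
  "smat_mult (lower_bidiagonal p \<alpha> k) A i j =
    A i j + (if i = 0 then 0 else \<alpha> (k + 1 + (i - 1) * (p + 1)) * A (i - 1) j)"
proof -
  have "smat_mult (lower_bidiagonal p \<alpha> k) A i j = (\<Sum>l\<in>{i - 1, i}. lower_bidiagonal p \<alpha> k i l * A l j)"
    unfolding smat_mult_def by (rule suminf_finite) (auto simp: lower_bidiagonal_def)
  then show ?thesis
    by (cases i) (auto simp: lower_bidiagonal_def)
qed

text \<open>A lower bidiagonal factor with unit diagonal and positive subdiagonal can only increase the entries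
  of a nonnegative matrix.\<close>

lemma bidiagonal_product_ge_upper:
  assumes \<alpha>: "\<And>i. i \<ge> 1 \<Longrightarrow> \<alpha> i > 0"
  shows "upper_bidiagonal p \<alpha> i j \<ge> 0 \<and>
    upper_bidiagonal p \<alpha> i j \<le> foldr smat_mult (map (lower_bidiagonal p \<alpha>) ks) (upper_bidiagonal p \<alpha>) i j"
proof (induction ks arbitrary: i)
  case Nil
  then show ?case
    using \<alpha> by (auto simp: upper_bidiagonal_def intro: less_imp_le)
next
  case (Cons k ks)
  let ?F = "foldr smat_mult (map (lower_bidiagonal p \<alpha>) ks) (upper_bidiagonal p \<alpha>)"
  have "?F i j \<ge> upper_bidiagonal p \<alpha> i j" "upper_bidiagonal p \<alpha> i j \<ge> 0" "?F (i - 1) j \<ge> 0"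
    using Cons.IH[of i] Cons.IH[of "i - 1"] by auto
  moreover have "\<alpha> (k + 1 + (i - 1) * (p + 1)) > 0"
    using \<alpha> by simp
  ultimately show ?case
    by (auto simp: smat_mult_lower_bidiagonal intro: add_increasing2)
qed

text \<open>The diagonal is at least that of \<open>U\<close>. The subdiagonal entries are positive because \<open>L\<^sub>1\<close> adds a
  positive multiple of row \<open>n\<close> to row \<open>n + 1\<close>, and the diagonal entry of row \<open>n\<close> of the remaining
  product is positive.\<close>

lemma positive_bidiagonal_factorization_entries:
  assumes p: "p \<ge> 1" and T: "positive_bidiagonal_factorization p T"
  shows "T i j \<ge> 0" and "T 0 0 > 0" and "T (Suc n) n > 0"
proof -
  obtain \<alpha> where \<alpha>: "\<And>i. i \<ge> 1 \<Longrightarrow> \<alpha> i > 0"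
    and T_eq: "T = foldr smat_mult (map (lower_bidiagonal p \<alpha>) [1..<p + 1]) (upper_bidiagonal p \<alpha>)"
    using T by (auto simp: positive_bidiagonal_factorization_def)
  note ge = bidiagonal_product_ge_upper[of \<alpha> p, OF \<alpha>]
  have diag: "upper_bidiagonal p \<alpha> m m > 0" for m
    using \<alpha> by (simp add: upper_bidiagonal_def)
  show "T i j \<ge> 0"
    using ge[of i j "[1..<p + 1]"] T_eq by simp
  show "T 0 0 > 0"
    using ge[of 0 0 "[1..<p + 1]"] diag[of 0] T_eq by simp
  define R where "R = foldr smat_mult (map (lower_bidiagonal p \<alpha>) [2..<p + 1]) (upper_bidiagonal p \<alpha>)"
  have R: "R (Suc n) n \<ge> 0" "R n n > 0"
    using ge[of "Suc n" n "[2..<p + 1]"] ge[of n n "[2..<p + 1]"] diag[of n] unfolding R_def by auto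
  have "[1..<p + 1] = 1 # [2..<p + 1]"
    using p by (simp add: upt_conv_Cons numeral_2_eq_2)
  then have "T = smat_mult (lower_bidiagonal p \<alpha> 1) R"
    by (simp add: T_eq R_def)
  moreover have "\<alpha> (2 + n * (p + 1)) > 0"
    using \<alpha> by simp
  ultimately show "T (Suc n) n > 0"
    using R by (simp add: smat_mult_lower_bidiagonal add_nonneg_pos)
qed

section \<open>The chain of a positive eigenvector\<close>

text \<open>Any two states communicate through 0: neighbours are joined in both directions, and the loop at 0
  provides a path of positive length even if \<open>N = 0\<close>.\<close>

lemma recurrent_doob_transform:
  fixes A :: "nat \<Rightarrow> nat \<Rightarrow> real" and v :: "nat \<Rightarrow> real"
  assumes nn: "\<And>i j. i \<le> N \<Longrightarrow> j \<le> N \<Longrightarrow> A i j \<ge> 0"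
    and diag: "A 0 0 > 0"
    and up: "\<And>i. i < N \<Longrightarrow> A i (Suc i) > 0" and down: "\<And>i. i < N \<Longrightarrow> A (Suc i) i > 0"
    and lam: "\<mu> > 0" and v: "\<And>i. i \<le> N \<Longrightarrow> v i > 0"
    and eigen: "\<And>i. i \<le> N \<Longrightarrow> (\<Sum>j\<le>N. A i j * v j) = \<mu> * v i"
    and P: "\<And>i j. i \<le> N \<Longrightarrow> j \<le> N \<Longrightarrow> P i j = A i j * v j / (\<mu> * v i)"
  shows "recurrent_markov_chain {0..N} P"
proof (rule finite_irreducible_recurrent)
  have "sum (P i) {0..N} = 1" if "i \<le> N" for i
  proof -
    have "sum (P i) {0..N} = (\<Sum>j\<le>N. A i j * v j) / (\<mu> * v i)"
      using P that by (simp add: sum_divide_distrib atLeast0AtMost)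
    then show ?thesis
      using eigen[OF that] lam v[OF that] by simp
  qed
  moreover have "P i j \<ge> 0" if "i \<le> N" "j \<le> N" for i j
    using P[OF that] nn[OF that] lam v that by (simp add: less_imp_le)
  ultimately show "stochastic_on {0..N} P"
    by (auto simp: stochastic_on_def intro!: has_sum_finiteI)
next
  define R where "R = {(a, b). a \<in> {0..N} \<and> b \<in> {0..N} \<and> P a b > 0}"
  have R: "(i, j) \<in> R" if "A i j > 0" "i \<le> N" "j \<le> N" for i j
    using that P lam v by (simp add: R_def)
  have to_0: "(s, 0) \<in> R\<^sup>*" if "s \<le> N" for s
    using that
  proof (induction s)
    case (Suc s)
    then show ?case
      using R[OF down[of s]] by (auto intro: converse_rtrancl_into_rtrancl)
  qed auto
  have from_0: "(0, i) \<in> R\<^sup>*" if "i \<le> N" for i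
    using that
  proof (induction i)
    case (Suc i)
    then show ?case
      using R[OF up[of i]] by (auto intro: rtrancl_into_rtrancl)
  qed auto
  show "(s, i) \<in> {(a, b). a \<in> {0..N} \<and> b \<in> {0..N} \<and> P a b > 0}\<^sup>+"
    if "s \<in> {0..N}" "i \<in> {0..N}" for s i
  proof -
    have "(s, 0) \<in> R\<^sup>+"
      using to_0[of s] R[OF diag] that by (auto intro: rtrancl_into_trancl1)
    then have "(s, i) \<in> R\<^sup>+"
      using from_0[of i] that by (auto intro: trancl_rtrancl_trancl)
    then show ?thesis
      by (simp only: R_def)
  qed
qed simp

lemma positive_left_right_eigenvalue_eq:
  fixes A :: "nat \<Rightarrow> nat \<Rightarrow> real"
  assumes v: "\<And>i. i \<le> N \<Longrightarrow> v i > 0" and w: "\<And>i. i \<le> N \<Longrightarrow> w i > 0"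
    and right: "\<And>i. i \<le> N \<Longrightarrow> (\<Sum>j\<le>N. A i j * v j) = \<mu> * v i"
    and left: "\<And>j. j \<le> N \<Longrightarrow> (\<Sum>i\<le>N. A i j * w i) = \<nu> * w j"
  shows "\<mu> = \<nu>"
proof -
  have "\<mu> * (\<Sum>i\<le>N. w i * v i) = (\<Sum>i\<le>N. w i * (\<Sum>j\<le>N. A i j * v j))"
    using right by (simp add: sum_distrib_left mult_ac)
  also have "\<dots> = (\<Sum>j\<le>N. (\<Sum>i\<le>N. A i j * w i) * v j)"
    unfolding sum_distrib_left sum_distrib_right by (subst sum.swap) (simp add: mult_ac)
  also have "\<dots> = \<nu> * (\<Sum>i\<le>N. w i * v i)"
    using left by (simp add: sum_distrib_left mult_ac)
  finally have "\<mu> * (\<Sum>i\<le>N. w i * v i) = \<nu> * (\<Sum>i\<le>N. w i * v i)" .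
  moreover have "(\<Sum>i\<le>N. w i * v i) > 0"
    using v w by (intro sum_pos) auto
  ultimately show ?thesis
    by simp
qed

section \<open>The two families of polynomials and the transition matrices\<close>

lemma type_II_poly_recurrence:
  assumes "banded_hessenberg p T"
  shows "type_II_poly p T (Suc n) = [:- T n n, 1:] * type_II_poly p T n -
    (\<Sum>m<n. Polynomial.smult (T n m) (type_II_poly p T m))"
proof -
  let ?b = "type_II_poly p T"
  have "(\<Sum>k\<in>{1..p}. if k \<le> n then Polynomial.smult (T n (n - k)) (?b (n - k)) else 0) =
      (\<Sum>k\<in>{k\<in>{1..p}. k \<le> n}. Polynomial.smult (T n (n - k)) (?b (n - k)))"
    by (rule sum.inter_filter[symmetric]) simp
  also have "\<dots> = (\<Sum>m\<in>{m\<in>{..<n}. n \<le> m + p}. Polynomial.smult (T n m) (?b m))"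
    by (rule sum.reindex_bij_witness[of _ "\<lambda>m. n - m" "\<lambda>k. n - k"]) auto
  also have "\<dots> = (\<Sum>m<n. Polynomial.smult (T n m) (?b m))"
    using assms by (intro sum.mono_neutral_left) (auto simp: banded_hessenberg_def)
  finally show ?thesis
    by simp
qed

lemma P_II_entry:
  assumes "i \<le> N" "j \<le> N"
  shows "P_II p T N $$ (i, j) =
    T i j * poly (type_II_poly p T j) (largest_eigenvalue T N) /
    (largest_eigenvalue T N * poly (type_II_poly p T i) (largest_eigenvalue T N))"
proof -
  have "P_II p T N $$ (i, j) =
      pi_II p T N i * (inverse (largest_eigenvalue T N) * T i j) * inverse (pi_II p T N j)"
    using assms unfolding P_II_def
    by (subst mat_diag_mult_left[of _ "N + 1" "N + 1"], simp add: trunc_mat_def,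
        subst mat_diag_mult_right[of _ "N + 1"]) (simp_all add: trunc_mat_def)
  then show ?thesis
    by (simp add: pi_II_def field_simps)
qed

lemma P_I_entry:
  assumes "i \<le> N" "j \<le> N" and "poly (truncated_poly T N 1) (largest_eigenvalue T N) \<noteq> 0"
  shows "P_I T N $$ (i, j) =
    T j i * poly (truncated_poly T N (Suc j)) (largest_eigenvalue T N) /
    (largest_eigenvalue T N * poly (truncated_poly T N (Suc i)) (largest_eigenvalue T N))"
proof -
  have "P_I T N $$ (i, j) =
      inverse (pi_I T N i) * (inverse (largest_eigenvalue T N) * T j i) * pi_I T N j"
    using assms(1,2) unfolding P_I_def
    by (subst mat_diag_mult_left[of _ "N + 1" "N + 1"], simp add: trunc_mat_def,
        subst mat_diag_mult_right[of _ "N + 1"]) (simp_all add: trunc_mat_def)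
  then show ?thesis
    using assms(3) by (simp add: pi_I_def field_simps)
qed

text \<open>The names \<open>\<mu>\<close> and \<open>\<nu>\<close> below stand for the largest roots obtained from \<open>T\<close> and from its reflection;
  they turn out to be equal to the largest eigenvalue.\<close>

theorem theorem9:
  fixes p :: nat and T :: "nat \<Rightarrow> nat \<Rightarrow> real" and N :: nat
  assumes "p \<ge> 1"
    and "banded_hessenberg p T"
    and "positive_bidiagonal_factorization p T"
    and "associated_stochastic T"
  shows "recurrent_markov_chain {0..N} (\<lambda>i j. P_II p T N $$ (i, j)) \<and>
    recurrent_markov_chain {0..N} (\<lambda>i j. P_I T N $$ (i, j))"
proof -
  note entries = positive_bidiagonal_factorization_entries[OF assms(1,3)]
  have super: "T n (Suc n) = 1" and zero: "Suc n < m \<Longrightarrow> T n m = 0" for n m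
    using assms(2) by (auto simp: banded_hessenberg_def)
  let ?\<rho> = "largest_eigenvalue T N"

  let ?b = "type_II_poly p T"
  have b0: "?b 0 = 1"
    by simp
  note b_rec = type_II_poly_recurrence[OF assms(2)]
  obtain \<mu> where \<mu>: "\<mu> \<ge> T 0 0" "poly (?b (Suc N)) \<mu> = 0" "\<And>n. n \<le> N \<Longrightarrow> poly (?b n) \<mu> > 0"
    using hessenberg_poly_largest_root[of ?b N T, OF b0 b_rec entries(1,3)] by blast
  have right: "(\<Sum>m\<le>N. T n m * poly (?b m) \<mu>) = \<mu> * poly (?b n) \<mu>" if "n \<le> N" for n
    using hessenberg_poly_eigen[of N ?b T, OF b_rec super zero \<mu>(2) that] by simp

  (* the left eigenvector, from the reflection of T in the antidiagonal *)
  let ?c = "\<lambda>n m. T (N - m) (N - n)" and ?d = "\<lambda>n. truncated_poly T N (Suc N - n)"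
  have d0: "?d 0 = 1"
    using truncated_poly_last[of T N] by simp
  have d_rec: "?d (Suc n) = [:- ?c n n, 1:] * ?d n - (\<Sum>m<n. Polynomial.smult (?c n m) (?d m))"
    if "n \<le> N" for n
    using truncated_poly_recurrence[of T n N, OF super zero that] by simp
  have c_sub: "?c (Suc n) n > 0" and c_super: "?c n (Suc n) = 1" if "n < N" for n
    using that entries(3)[of "N - Suc n"] super[of "N - Suc n"] by (simp_all add: Suc_diff_Suc)
  have c_zero: "?c n m = 0" if "Suc n < m" "m \<le> N" for n m
    using that by (intro zero) linarith
  obtain \<nu> where \<nu>: "poly (?d (Suc N)) \<nu> = 0" "\<And>x. x > \<nu> \<Longrightarrow> poly (?d (Suc N)) x > 0"
    "\<And>n. n \<le> N \<Longrightarrow> poly (?d n) \<nu> > 0"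
    using hessenberg_poly_largest_root[of ?d N ?c, OF d0 d_rec entries(1) c_sub] by blast
  let ?w = "\<lambda>i. poly (truncated_poly T N (Suc i)) \<nu>"
  have w: "?w i > 0" if "i \<le> N" for i
    using \<nu>(3)[of "N - i"] that by (simp add: Suc_diff_le)
  have left: "(\<Sum>i\<le>N. T i j * ?w i) = \<nu> * ?w j" if j: "j \<le> N" for j
  proof -
    have "(\<Sum>i\<le>N. T i j * ?w i) = (\<Sum>m\<le>N. ?c (N - j) m * poly (?d m) \<nu>)"
      using j by (intro sum.reindex_bij_witness[of _ "\<lambda>m. N - m" "\<lambda>m. N - m"]) (auto simp: Suc_diff_le)
    also have "\<dots> = \<nu> * poly (?d (N - j)) \<nu>"
      by (rule hessenberg_poly_eigen[of N ?d ?c, OF d_rec c_super c_zero \<nu>(1)]) auto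
    finally show ?thesis
      using j by (simp add: Suc_diff_le)
  qed

  have "\<mu> = \<nu>"
    by (rule positive_left_right_eigenvalue_eq[of N "\<lambda>i. poly (?b i) \<mu>" ?w T, OF \<mu>(3) w right left])
  have spectrum: "{x. eigenvalue (trunc_mat T N 0) x} = {x. poly (?d (Suc N)) x = 0}"
  proof -
    have "trunc_mat T N 0 \<in> carrier_mat (N + 1) (N + 1)"
      by (simp add: trunc_mat_def)
    then show ?thesis
      by (simp add: eigenvalue_root_char_poly truncated_poly_def)
  qed
  have nz: "?d (Suc N) \<noteq> 0"
    using \<nu>(2)[of "\<nu> + 1"] by auto
  have lam: "?\<rho> = \<nu>"
    unfolding largest_eigenvalue_def spectrum
  proof (rule Max_eqI)
    show "finite {x. poly (?d (Suc N)) x = 0}"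
      using nz by (rule poly_roots_finite)
    show "x \<le> \<nu>" if "x \<in> {x. poly (?d (Suc N)) x = 0}" for x
      using \<nu>(2)[of x] that by (cases "x > \<nu>") auto
  qed (use \<nu>(1) in simp)
  have pos: "\<nu> > 0"
    using \<mu>(1) entries(2) \<open>\<mu> = \<nu>\<close> by simp

  show ?thesis
  proof
    show "recurrent_markov_chain {0..N} (\<lambda>i j. P_II p T N $$ (i, j))"
    proof (rule recurrent_doob_transform[of N T \<nu> "\<lambda>i. poly (?b i) \<nu>"])
      show "P_II p T N $$ (i, j) = T i j * poly (?b j) \<nu> / (\<nu> * poly (?b i) \<nu>)"
        if "i \<le> N" "j \<le> N" for i j
        using P_II_entry[OF that] lam by simp
    qed (use entries super pos \<mu>(3) right \<open>\<mu> = \<nu>\<close> in auto)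
    show "recurrent_markov_chain {0..N} (\<lambda>i j. P_I T N $$ (i, j))"
    proof (rule recurrent_doob_transform[of N "\<lambda>i j. T j i" \<nu> ?w])
      show "P_I T N $$ (i, j) = T j i * ?w j / (\<nu> * ?w i)" if "i \<le> N" "j \<le> N" for i j
        using P_I_entry[OF that] w[of 0] lam by simp
    qed (use entries super pos w left in auto)
  qed
qed

end
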